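(* Let $d\ge 1$ be an integer and $q\in[0,1)$. There exists a constant $C$ depending only on $d$ and $q$ such that for every interval $I=(a,b]$ with $a<b$ real, every interval filtration $(\mathscr F_n)_{n\ge1}$ on $I^d$ and every $f\in L^1(I^d)$, the maximal function $$\mathscr M f(x)=\sup_{n\ge 1}\ \sum_{A\in\mathcal A(\mathscr F_n)} \frac{q^{d_n(A,A_n(x))}}{|\mathrm{re}(A\cup A_n(x))|}\int_A |f|\,d\lambda^d,\qquad x\in I^d,$$ satisfies $$|\{x\in I^d:\ \mathscr M f(x)>t\}|\le \frac{C}{t}\,\|f\|_{L^1(I^d)},\qquad t>0.$$
   Context: Let $I=(a,b]$ with $a<b$ real. An interval $\sigma$-algebra on $I$ is a $\sigma$-algebra generated by a partition of $I$ into finitely many intervals of the form $(c,c']$ with $c<c'$. An interval filtration on $I^d$ is a sequence $\mathscr F_n=\mathscr F_n^1\otimes\cdots\otimes\mathscr F_n^d$, $n\ge1$, where for each $\ell$, $(\mathscr F_n^\ell)_n$ is an increasing sequence of interval $\sigma$-algebras on $I$. The atoms of $\mathscr F_n$ are the rectangles $A_1\times\cdots\times A_d$ with $A_\ell$ an atom of $\mathscr F_n^\ell$; the finite set of atoms is denoted $\mathcal A(\mathscr F_n)$. Number the atoms of each $\mathscr F_n^\ell$ from left to right by consecutive integers; this indexes the atoms of $\mathscr F_n$ as $I_{n,i}$ by multi-indices $i=(i_1,\dots,i_d)\in\mathbb Z^d$. For $x\in I^d$, $A_n(x)$ is the atom of $\mathscr F_n$ containing $x$. For atoms $A=I_{n,i}$,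 $B=I_{n,j}$ put $d_n(A,B)=|i-j|_1=\sum_{\ell}|i_\ell-j_\ell|$. For a set $S$, $\mathrm{re}(S)$ is the smallest axis-parallel rectangle containing $S$. $|\cdot|=\lambda^d$ is $d$-dimensional Lebesgue measure, and $0^0=1$. *)

theory Defs
  imports "HOL-Analysis.Analysis"
begin

text \<open>\<sigma>-algebras are represented by their families of measurable sets, as in \<^const>\<open>sigma_sets\<close>.\<close>

definition interval_sigma_algebra :: "real \<Rightarrow> real \<Rightarrow> real set set \<Rightarrow> bool" where
  "interval_sigma_algebra a b M \<longleftrightarrow>
     (\<exists>P. finite P \<and> partition_on {a<..b} P \<and>
          (\<forall>A\<in>P. \<exists>c c'. c < c' \<and> A = {c<..c'}) \<and>
          M = sigma_sets {a<..b} P)"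

definition atoms :: "'a set set \<Rightarrow> 'a set set" where
  "atoms M = {A \<in> M. A \<noteq> {} \<and> (\<forall>B\<in>M. B \<subseteq> A \<longrightarrow> B = {} \<or> B = A)}"

definition cart_box :: "('n \<Rightarrow> real set) \<Rightarrow> (real^'n) set" where
  "cart_box J = {x. \<forall>l. x $ l \<in> J l}"

definition cube :: "real \<Rightarrow> real \<Rightarrow> (real^'n) set" where
  "cube a b = cart_box (\<lambda>_. {a<..b})"

definition prod_sigma_algebra :: "real \<Rightarrow> real \<Rightarrow> ('n \<Rightarrow> real set set) \<Rightarrow> (real^'n) set set" where
  "prod_sigma_algebra a b M = sigma_sets (cube a b) {cart_box J |J. \<forall>l. J l \<in> M l}"

text \<open>An interval filtration is given by its coordinate filtrations: \<open>F n l\<close> is the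
  \<open>n\<close>-th \<sigma>-algebra in direction \<open>l\<close>, and \<open>prod_sigma_algebra a b (F n)\<close> is the \<open>n\<close>-th
  \<sigma>-algebra on the cube. Time starts at 1; \<open>F 0\<close> is irrelevant.\<close>

definition interval_filtration :: "real \<Rightarrow> real \<Rightarrow> (nat \<Rightarrow> 'n \<Rightarrow> real set set) \<Rightarrow> bool" where
  "interval_filtration a b F \<longleftrightarrow>
     (\<forall>l. (\<forall>n\<ge>1. interval_sigma_algebra a b (F n l)) \<and>
          (\<forall>m\<ge>1. \<forall>n\<ge>m. F m l \<subseteq> F n l))"

definition atom_at :: "'a set set \<Rightarrow> 'a \<Rightarrow> 'a set" where
  "atom_at M x = (THE A. A \<in> atoms M \<and> x \<in> A)"

text \<open>The left-to-right position of the atom \<open>A\<close> among the atoms of \<open>M\<close>, counted from 0.\<close>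

definition atom_index :: "real set set \<Rightarrow> real set \<Rightarrow> int" where
  "atom_index M A = int (card {B \<in> atoms M. \<forall>x\<in>B. \<forall>y\<in>A. x < y})"

text \<open>The \<open>l\<close>-th factor of a product atom is its projection to the \<open>l\<close>-th coordinate.\<close>

definition multi_index :: "('n \<Rightarrow> real set set) \<Rightarrow> (real^'n) set \<Rightarrow> 'n \<Rightarrow> int" where
  "multi_index M A l = atom_index (M l) ((\<lambda>x. x $ l) ` A)"

definition atom_dist :: "('n::finite \<Rightarrow> real set set) \<Rightarrow> (real^'n) set \<Rightarrow> (real^'n) set \<Rightarrow> nat" where
  "atom_dist M A B = nat (\<Sum>l\<in>UNIV. \<bar>multi_index M A l - multi_index M B l\<bar>)"

definition rectangle :: "(real^'n) set \<Rightarrow> bool" where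
  "rectangle R \<longleftrightarrow> (\<exists>J. (\<forall>l. is_interval (J l)) \<and> R = cart_box J)"

definition re :: "(real^'n) set \<Rightarrow> (real^'n) set" where
  "re S = rectangle hull S"

definition maximal_fun ::
  "real \<Rightarrow> real \<Rightarrow> real \<Rightarrow> (nat \<Rightarrow> 'n::finite \<Rightarrow> real set set) \<Rightarrow> (real^'n \<Rightarrow> real) \<Rightarrow> real^'n \<Rightarrow> ennreal" where
  "maximal_fun q a b F f x =
     (SUP n\<in>{1..}. ennreal
        (\<Sum>A\<in>atoms (prod_sigma_algebra a b (F n)).
           q ^ atom_dist (F n) A (atom_at (prod_sigma_algebra a b (F n)) x) /
           measure lebesgue (re (A \<union> atom_at (prod_sigma_algebra a b (F n)) x)) *
           (LINT y:A|lebesgue. \<bar>f y\<bar>)))"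

lemma atoms_sigma_sets:
  assumes G: "G \<subseteq> Pow \<Omega>" and R: "R \<subseteq> sigma_sets \<Omega> G" and cover: "\<Union>R = \<Omega>" and ne: "{} \<notin> R"
    and split: "\<And>A B. A \<in> R \<Longrightarrow> B \<in> G \<Longrightarrow> A \<subseteq> B \<or> A \<inter> B = {}"
  shows "atoms (sigma_sets \<Omega> G) = R"
proof -
  have split': "A \<subseteq> B \<or> A \<inter> B = {}" if "A \<in> R" "B \<in> sigma_sets \<Omega> G" for A B
    using that(2)
  proof (induction rule: sigma_sets.induct)
    case (Basic B) then show ?case using split that(1) by blast
  next
    case Empty then show ?case by simp
  next
    case (Compl B) then show ?case using cover that(1) by blast
  next
    case (Union B) then show ?case by blast
  qed
  show ?thesis
  proof (intro equalityI subsetI)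
    fix X assume X: "X \<in> atoms (sigma_sets \<Omega> G)"
    then have XS: "X \<in> sigma_sets \<Omega> G" and "X \<noteq> {}" by (auto simp: atoms_def)
    then obtain x where x: "x \<in> X" by blast
    have "x \<in> \<Omega>" using sigma_sets_into_sp[OF G XS] x by blast
    then obtain A where A: "A \<in> R" "x \<in> A" using cover by blast
    then have "A \<subseteq> X" using split'[OF A(1) XS] x by blast
    then have "A = X" using X A R by (auto simp: atoms_def)
    then show "X \<in> R" using A by simp
  next
    fix A assume A: "A \<in> R"
    then show "A \<in> atoms (sigma_sets \<Omega> G)"
      unfolding atoms_def using R ne split'[OF A] by blast
  qed
qed

lemma atoms_sigma_sets_partition:
  assumes "partition_on \<Omega> P"
  shows "atoms (sigma_sets \<Omega> P) = P"
proof (rule atoms_sigma_sets)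
  show "P \<subseteq> Pow \<Omega>" "\<Union>P = \<Omega>" "{} \<notin> P"
    using assms by (auto simp: partition_on_def)
  show "A \<subseteq> B \<or> A \<inter> B = {}" if "A \<in> P" "B \<in> P" for A B
    using assms that by (auto simp: partition_on_def disjoint_def)
qed auto

lemma atoms_prod_sigma_algebra:
  fixes M :: "'n::finite \<Rightarrow> real set set"
  assumes "\<And>l. interval_sigma_algebra a b (M l)"
  shows "atoms (prod_sigma_algebra a b M) = {cart_box J |J. \<forall>l. J l \<in> atoms (M l)}"
proof -
  have "\<forall>l. \<exists>P. partition_on {a<..b} P \<and> M l = sigma_sets {a<..b} P"
    using assms unfolding interval_sigma_algebra_def by blast
  then obtain P where P: "\<And>l. partition_on {a<..b} (P l)"
    and M: "\<And>l. M l = sigma_sets {a<..b} (P l)" by metis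
  have at: "atoms (M l) = P l" for l using atoms_sigma_sets_partition[OF P] M by simp
  have PM: "A \<in> M l" if "A \<in> P l" for A l using that M by auto
  have PP: "P l \<subseteq> Pow {a<..b}" for l using P[of l] by (auto simp: partition_on_def)
  have MS: "A \<subseteq> {a<..b}" if "A \<in> M l" for A l
    using sigma_sets_into_sp[OF PP] that M by auto
  show ?thesis unfolding prod_sigma_algebra_def
  proof (rule atoms_sigma_sets)
    show "{cart_box J |J. \<forall>l. J l \<in> M l} \<subseteq> Pow (cube a b)"
      using MS by (fastforce simp: cart_box_def cube_def)
    show "{cart_box J |J. \<forall>l. J l \<in> atoms (M l)}
        \<subseteq> sigma_sets (cube a b) {cart_box J |J. \<forall>l. J l \<in> M l}"
      using PM at by blast
    show "\<Union> {cart_box J |J. \<forall>l. J l \<in> atoms (M l)} = cube a b"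
    proof (intro equalityI subsetI)
      fix x assume "x \<in> \<Union> {cart_box J |J. \<forall>l. J l \<in> atoms (M l)}"
      then show "x \<in> cube a b" using PP at by (fastforce simp: cart_box_def cube_def)
    next
      fix x :: "real^'n" assume "x \<in> cube a b"
      then have "x $ l \<in> {a<..b}" for l by (simp add: cart_box_def cube_def)
      then have "x $ l \<in> \<Union>(P l)" for l using partition_onD1[OF P[of l]] by metis
      then have "\<forall>l. \<exists>A. A \<in> P l \<and> x $ l \<in> A" by blast
      then obtain J where "\<And>l. J l \<in> P l \<and> x $ l \<in> J l" by metis
      then show "x \<in> \<Union> {cart_box J |J. \<forall>l. J l \<in> atoms (M l)}"
        unfolding at by (auto simp: cart_box_def)
    qed
    show "{} \<notin> {cart_box J |J. \<forall>l. J l \<in> atoms (M l)}"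
    proof
      assume "{} \<in> {cart_box J |J. \<forall>l. J l \<in> atoms (M l)}"
      then obtain J where J: "cart_box J = {}" "\<forall>l. J l \<in> atoms (M l)" by auto
      then have "\<forall>l. \<exists>y. y \<in> J l" by (auto simp: atoms_def)
      then obtain y where "\<And>l. y l \<in> J l" by metis
      then have "(\<chi> l. y l) \<in> cart_box J" by (simp add: cart_box_def)
      then show False using J by simp
    qed
    fix A B
    assume "A \<in> {cart_box J |J. \<forall>l. J l \<in> atoms (M l)}" "B \<in> {cart_box J |J. \<forall>l. J l \<in> M l}"
    then obtain J K where J: "A = cart_box J" "\<And>l. J l \<in> atoms (M l)"
      and K: "B = cart_box K" "\<And>l. K l \<in> M l" by auto
    have "J l \<subseteq> K l \<or> J l \<inter> K l = {}" for l
    proof -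
      interpret sigma_algebra "{a<..b}" "M l"
        unfolding M by (rule sigma_algebra_sigma_sets[OF PP])
      have JM: "J l \<in> M l" using J(2)[of l] by (simp add: atoms_def)
      have "J l \<inter> K l \<in> M l" by (rule Int[OF JM K(2)])
      then show ?thesis using J(2)[of l] unfolding atoms_def by fastforce
    qed
    then consider "\<And>l. J l \<subseteq> K l" | l where "J l \<inter> K l = {}" by blast
    then show "A \<subseteq> B \<or> A \<inter> B = {}"
    proof cases
      case 1
      then show ?thesis unfolding J(1) K(1) cart_box_def by blast
    next
      case 2
      then show ?thesis unfolding J(1) K(1) cart_box_def by blast
    qed
  qed
qed

end

theory Submission
  imports Defs
begin

text \<open>Fix an offset \<open>k\<close> and consider the pairs of atoms \<open>A\<close>, \<open>B\<close> of the same
  \<open>\<sigma>\<close>-algebra whose indices differ by \<open>k\<close> and for which \<open>\<integral>\<^sub>B |f| > s |re (A \<union> B)|\<close>. Among them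
  select the pairs whose \<open>B\<close> is maximal, at the earliest time. The selected \<open>B\<close> are disjoint, and every
  other \<open>A\<close> lies in \<open>re (A' \<union> B')\<close> for a selected pair, because refining a partition only
  increases index distances. So the union of all the \<open>A\<close> has measure at most \<open>\<parallel>f\<parallel> / s\<close>, without
  loss in \<open>k\<close>. With \<open>r = (1 + q) / 2\<close>, so \<open>q \<le> r\<^sup>2\<close>, and \<open>S = (2 / (1 - r))\<^sup>d\<close>, a bound for the
  sum of all \<open>r\<^bsup>|k|\<^esup>\<close>, a point where the maximal function exceeds \<open>t\<close> belongs to such an \<open>A\<close> for some
  \<open>k\<close> and \<open>s = t / (S r\<^bsup>|k|\<^esup>)\<close>. Summing over \<open>k\<close> gives the constant \<open>S\<^sup>2\<close>.\<close>

section \<open>Endpoint counts in one dimension\<close>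

text \<open>On an atom this is its index. Counting endpoints instead of atoms makes the monotonicity of
  index differences under refinement an inclusion of sets.\<close>

definition endpoint_count :: "real set set \<Rightarrow> real \<Rightarrow> nat" where
  "endpoint_count M x = card {e \<in> Sup ` atoms M. e < x}"

lemma interval_sigma_algebra_atoms:
  assumes "interval_sigma_algebra a b M"
  shows "finite (atoms M)" "partition_on {a<..b} (atoms M)" "M = sigma_sets {a<..b} (atoms M)"
    and "\<And>A. A \<in> atoms M \<Longrightarrow> \<exists>c c'. c < c' \<and> A = {c<..c'}"
proof -
  obtain P where P: "finite P" "partition_on {a<..b} P" "\<forall>A\<in>P. \<exists>c c'. c < c' \<and> A = {c<..c'}"
    "M = sigma_sets {a<..b} P"
    using assms unfolding interval_sigma_algebra_def by blast
  have "atoms M = P" using atoms_sigma_sets_partition[OF P(2)] P(4) by simp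
  then show "finite (atoms M)" "partition_on {a<..b} (atoms M)" "M = sigma_sets {a<..b} (atoms M)"
    and "\<And>A. A \<in> atoms M \<Longrightarrow> \<exists>c c'. c < c' \<and> A = {c<..c'}"
    using P by auto
qed

lemma atom_eq_Ioc:
  assumes "interval_sigma_algebra a b M" "A \<in> atoms M"
  obtains c where "c < Sup A" "A = {c<..Sup A}"
proof -
  obtain c c' where "c < c'" "A = {c<..c'}"
    using interval_sigma_algebra_atoms(4)[OF assms] by blast
  then show ?thesis using that[of c] by simp
qed

lemma atoms_eq_if_common_point:
  assumes "interval_sigma_algebra a b M" "A \<in> atoms M" "B \<in> atoms M" "x \<in> A" "x \<in> B"
  shows "A = B"
  using interval_sigma_algebra_atoms(2)[OF assms(1)] assms(2-)
  by (auto simp: partition_on_def disjoint_def)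

lemma atom_subset_Ioc:
  assumes "interval_sigma_algebra a b M" "A \<in> atoms M"
  shows "A \<subseteq> {a<..b}"
  using interval_sigma_algebra_atoms(2)[OF assms(1)] assms(2)
  by (auto simp: partition_on_def)

lemma ex_atom:
  assumes "interval_sigma_algebra a b M" "x \<in> {a<..b}"
  obtains A where "A \<in> atoms M" "x \<in> A"
  using partition_onD1[OF interval_sigma_algebra_atoms(2)[OF assms(1)]] assms(2) by blast

text \<open>The coarse atom belongs to the finer algebra \<open>N\<close>, so
  \<open>A \<inter> B\<close> does too, and minimality of \<open>A\<close> in \<open>N\<close>
  leaves two possibilities.\<close>

lemma fine_atom_subset_or_disjoint:
  assumes M: "interval_sigma_algebra a b M" and N: "interval_sigma_algebra a b N" and "M \<subseteq> N"
    and A: "A \<in> atoms N" and B: "B \<in> atoms M"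
  shows "A \<subseteq> B \<or> A \<inter> B = {}"
proof -
  interpret sigma_algebra "{a<..b}" N
    by (subst interval_sigma_algebra_atoms(3)[OF N], rule sigma_algebra_sigma_sets)
      (use atom_subset_Ioc[OF N] in blast)
  have "A \<in> N" "B \<in> N" using A B \<open>M \<subseteq> N\<close> by (auto simp: atoms_def)
  then have "A \<inter> B \<in> N" by (rule Int)
  then show ?thesis using A unfolding atoms_def by fastforce
qed

text \<open>Each atom contains its supremum and is determined by it. An atom \<open>B\<close>
  therefore lies left of \<open>A\<close> exactly when \<open>Sup B < x\<close>: otherwise
  \<open>Sup B\<close> would fall into \<open>A\<close> and force \<open>A = B\<close>.\<close>

lemma atom_index_eq_endpoint_count:
  assumes M: "interval_sigma_algebra a b M" and A: "A \<in> atoms M" and x: "x \<in> A"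
  shows "atom_index M A = int (endpoint_count M x)"
proof -
  have left: "(\<forall>u\<in>B. \<forall>v\<in>A. u < v) \<longleftrightarrow> Sup B < x" if B: "B \<in> atoms M" for B
  proof -
    obtain d where d: "d < Sup B" "B = {d<..Sup B}" by (rule atom_eq_Ioc[OF M B])
    obtain c where c: "c < Sup A" "A = {c<..Sup A}" by (rule atom_eq_Ioc[OF M A])
    have SB: "Sup B \<in> B" using d by (metis greaterThanAtMost_iff order_refl)
    show ?thesis
    proof
      assume "\<forall>u\<in>B. \<forall>v\<in>A. u < v"
      then show "Sup B < x" using SB x by blast
    next
      assume less: "Sup B < x"
      show "\<forall>u\<in>B. \<forall>v\<in>A. u < v"
      proof (rule ccontr)
        assume "\<not> (\<forall>u\<in>B. \<forall>v\<in>A. u < v)"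
        then obtain u v where uv: "u \<in> B" "v \<in> A" "v \<le> u" by fastforce
        have "u \<le> Sup B" using uv(1) d(2) by (metis greaterThanAtMost_iff)
        moreover have "c < v" "x \<le> Sup A" using uv(2) x c(2) by (metis greaterThanAtMost_iff)+
        ultimately have "Sup B \<in> {c<..Sup A}" using uv(3) less by auto
        then have "Sup B \<in> A" using c(2) by blast
        then have "A = B" using atoms_eq_if_common_point[OF M A B _ SB] by blast
        then show False using less \<open>x \<le> Sup A\<close> by simp
      qed
    qed
  qed
  have "inj_on Sup (atoms M)"
  proof (rule inj_onI)
    fix B C assume B: "B \<in> atoms M" and C: "C \<in> atoms M" and eq: "Sup B = Sup C"
    obtain d where d: "d < Sup B" "B = {d<..Sup B}" by (rule atom_eq_Ioc[OF M B])
    obtain c where c: "c < Sup C" "C = {c<..Sup C}" by (rule atom_eq_Ioc[OF M C])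
    have "Sup B \<in> B" "Sup C \<in> C" using d c by (metis greaterThanAtMost_iff order_refl)+
    then show "B = C" using atoms_eq_if_common_point[OF M B C] eq by simp
  qed
  then have "card (Sup ` {B \<in> atoms M. Sup B < x}) = card {B \<in> atoms M. Sup B < x}"
    by (intro card_image) (auto simp: inj_on_def)
  moreover have "Sup ` {B \<in> atoms M. Sup B < x} = {e \<in> Sup ` atoms M. e < x}" by blast
  moreover have "{B \<in> atoms M. \<forall>u\<in>B. \<forall>v\<in>A. u < v} = {B \<in> atoms M. Sup B < x}"
    using left by blast
  ultimately show ?thesis unfolding atom_index_def endpoint_count_def by simp
qed

lemma endpoint_count_diff:
  assumes M: "interval_sigma_algebra a b M" and "x \<le> y"
  shows "endpoint_count M y = endpoint_count M x + card {e \<in> Sup ` atoms M. x \<le> e \<and> e < y}"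
proof -
  have "{e \<in> Sup ` atoms M. e < y} = {e \<in> Sup ` atoms M. e < x} \<union> {e \<in> Sup ` atoms M. x \<le> e \<and> e < y}"
    using assms(2) by auto
  then show ?thesis unfolding endpoint_count_def
    using interval_sigma_algebra_atoms(1)[OF M] by (auto intro!: card_Un_disjoint)
qed

lemma endpoint_count_mono:
  assumes "interval_sigma_algebra a b M" "x \<le> y"
  shows "endpoint_count M x \<le> endpoint_count M y"
  using endpoint_count_diff[OF assms] by simp

text \<open>Equal counts mean that no right endpoint lies in the half-open range from the smaller
  point to the larger one, so the atom of the smaller point extends to the larger.\<close>

lemma same_atom_if_endpoint_count_eq:
  assumes M: "interval_sigma_algebra a b M" and A: "A \<in> atoms M" and x: "x \<in> A"
    and y: "y \<in> {a<..b}" and eq: "endpoint_count M x = endpoint_count M y"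
  shows "y \<in> A"
proof -
  have *: "v \<in> C" if C: "C \<in> atoms M" and u: "u \<in> C" and "u \<le> v" "endpoint_count M u = endpoint_count M v" for C u v
  proof -
    obtain c where c: "c < Sup C" "C = {c<..Sup C}" by (rule atom_eq_Ioc[OF M C])
    have "card {e \<in> Sup ` atoms M. u \<le> e \<and> e < v} = 0"
      using endpoint_count_diff[OF M \<open>u \<le> v\<close>] that(4) by simp
    then have "{e \<in> Sup ` atoms M. u \<le> e \<and> e < v} = {}"
      using interval_sigma_algebra_atoms(1)[OF M] by (subst (asm) card_0_eq) auto
    moreover have "c < u \<and> u \<le> Sup C" using u c(2) by (metis greaterThanAtMost_iff)
    ultimately have "v \<in> {c<..Sup C}" using C \<open>u \<le> v\<close> by fastforce
    then show ?thesis using c(2) by blast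
  qed
  show ?thesis
  proof (cases "x \<le> y")
    case True
    then show ?thesis using *[OF A x] eq by blast
  next
    case False
    obtain B where B: "B \<in> atoms M" "y \<in> B" using ex_atom[OF M y] .
    then have "x \<in> B" using *[OF B] False eq by simp
    then show ?thesis using atoms_eq_if_common_point[OF M A B(1) x] B(2) by blast
  qed
qed

text \<open>Right endpoints survive refinement: the fine atom containing \<open>Sup A\<close> lies
  inside \<open>A\<close>, hence ends at \<open>Sup A\<close> as well.\<close>

lemma endpoint_count_diff_refine:
  assumes M: "interval_sigma_algebra a b M" and N: "interval_sigma_algebra a b N" and MN: "M \<subseteq> N"
    and "x \<le> y"
  shows "int (endpoint_count M y) - int (endpoint_count M x) \<le> int (endpoint_count N y) - int (endpoint_count N x)"
proof -
  have "Sup ` atoms M \<subseteq> Sup ` atoms N"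
  proof (rule image_subsetI)
    fix A assume A: "A \<in> atoms M"
    obtain c where c: "c < Sup A" "A = {c<..Sup A}" by (rule atom_eq_Ioc[OF M A])
    have SA: "Sup A \<in> A" using c by (metis greaterThanAtMost_iff order_refl)
    then have "Sup A \<in> {a<..b}" using atom_subset_Ioc[OF M A] by blast
    then obtain D where D: "D \<in> atoms N" "Sup A \<in> D" using ex_atom[OF N] by blast
    obtain d where d: "d < Sup D" "D = {d<..Sup D}" by (rule atom_eq_Ioc[OF N D(1)])
    have "D \<subseteq> A" using fine_atom_subset_or_disjoint[OF M N MN D(1) A] D(2) SA by blast
    moreover have "Sup D \<in> D" using d by (metis greaterThanAtMost_iff order_refl)
    ultimately have "Sup D \<le> Sup A" using c(2) by (metis greaterThanAtMost_iff subsetD)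
    moreover have "Sup A \<le> Sup D" using D(2) d(2) by (metis greaterThanAtMost_iff)
    ultimately have "Sup A = Sup D" by simp
    then show "Sup A \<in> Sup ` atoms N" using D(1) by blast
  qed
  then have "card {e \<in> Sup ` atoms M. x \<le> e \<and> e < y} \<le> card {e \<in> Sup ` atoms N. x \<le> e \<and> e < y}"
    using interval_sigma_algebra_atoms(1)[OF N] by (intro card_mono) auto
  then show ?thesis using endpoint_count_diff[OF M \<open>x \<le> y\<close>] endpoint_count_diff[OF N \<open>x \<le> y\<close>] by simp
qed

text \<open>One-dimensional core of the absorption argument. If \<open>x\<close> lies between
  \<open>y\<close> and \<open>x'\<close>, convexity of \<open>J\<close> suffices. If
  \<open>x\<close> lies beyond both, its coarse count difference from \<open>y\<close> is at most
  the fine one, which equals that of \<open>x'\<close>; monotonicity then gives \<open>x\<close> and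
  \<open>x'\<close> the same coarse count, so \<open>x\<close> is in \<open>A\<close>.\<close>

lemma between_if_same_endpoint_count_diff:
  assumes M: "interval_sigma_algebra a b M" and N: "interval_sigma_algebra a b N" and MN: "M \<subseteq> N"
    and A: "A \<in> atoms M" "x' \<in> A" and x: "x \<in> {a<..b}"
    and eq: "int (endpoint_count N x) - int (endpoint_count N y) = int (endpoint_count M x') - int (endpoint_count M y)"
    and J: "is_interval J" "A \<subseteq> J" "y \<in> J"
  shows "x \<in> J"
proof -
  have "x' \<in> J" using A J by blast
  have xA: "x \<in> J" if "endpoint_count M x = endpoint_count M x'"
    using same_atom_if_endpoint_count_eq[OF M A x] that J(2) by auto
  consider "y \<le> x" "x \<le> x'" | "y \<le> x" "x' \<le> x" | "x \<le> y" "x' \<le> x" | "x \<le> y" "x \<le> x'" by linarith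
  then show ?thesis
  proof cases
    case 1
    then show ?thesis using J \<open>x' \<in> J\<close> by (metis is_interval_1)
  next
    case 2
    then have "endpoint_count M x = endpoint_count M x'"
      using endpoint_count_diff_refine[OF M N MN 2(1)] endpoint_count_mono[OF M 2(2)] eq by simp
    then show ?thesis by (rule xA)
  next
    case 3
    then show ?thesis using J \<open>x' \<in> J\<close> by (metis is_interval_1)
  next
    case 4
    then have "endpoint_count M x = endpoint_count M x'"
      using endpoint_count_diff_refine[OF M N MN 4(1)] endpoint_count_mono[OF M 4(2)] eq by simp
    then show ?thesis by (rule xA)
  qed
qed

section \<open>Atoms of the product algebra\<close>

text \<open>All factors are nonempty, so projecting the box recovers each factor. This links boxes
  with \<open>multi_index\<close>, which is defined by projections.\<close>

lemma cart_box_atom_cases: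
  fixes M :: "'n::finite \<Rightarrow> real set set"
  assumes "\<And>l. interval_sigma_algebra a b (M l)" "A \<in> atoms (prod_sigma_algebra a b M)"
  obtains J where "A = cart_box J" "\<And>l. J l \<in> atoms (M l)" "\<And>l. (\<lambda>x. x $ l) ` A = J l"
proof -
  obtain J where J: "A = cart_box J" "\<And>l. J l \<in> atoms (M l)"
    using assms(2) unfolding atoms_prod_sigma_algebra[OF assms(1)] by blast
  have "\<forall>l. \<exists>y. y \<in> J l" using J(2) by (auto simp: atoms_def)
  then obtain y where y: "\<And>l. y l \<in> J l" by metis
  have "(\<lambda>x. x $ l) ` A = J l" for l
  proof (intro equalityI subsetI)
    fix u assume "u \<in> J l"
    then have "(\<chi> i. if i = l then u else y i) \<in> A"
      unfolding J(1) cart_box_def using y by simp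
    then show "u \<in> (\<lambda>x. x $ l) ` A" by (rule rev_image_eqI) simp
  qed (auto simp: J(1) cart_box_def)
  then show ?thesis using that J by blast
qed

lemma multi_index_eq_endpoint_count:
  fixes M :: "'n::finite \<Rightarrow> real set set"
  assumes M: "\<And>l. interval_sigma_algebra a b (M l)" and A: "A \<in> atoms (prod_sigma_algebra a b M)"
    and x: "x \<in> A"
  shows "multi_index M A l = int (endpoint_count (M l) (x $ l))"
proof -
  obtain J where J: "A = cart_box J" "\<And>l. J l \<in> atoms (M l)" "\<And>l. (\<lambda>x. x $ l) ` A = J l"
    using cart_box_atom_cases[OF M A] by metis
  have "x $ l \<in> J l" using J(3) x by blast
  then show ?thesis unfolding multi_index_def J(3) using atom_index_eq_endpoint_count[OF M J(2)] by blast
qed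

lemma prod_atom_ex:
  fixes M :: "'n::finite \<Rightarrow> real set set"
  assumes M: "\<And>l. interval_sigma_algebra a b (M l)" and x: "x \<in> cube a b"
  obtains A where "A \<in> atoms (prod_sigma_algebra a b M)" "x \<in> A"
proof -
  have "\<exists>A. A \<in> atoms (M l) \<and> x $ l \<in> A" for l
    using ex_atom[OF M, of "x $ l"] x unfolding cube_def cart_box_def by blast
  then obtain J where J: "\<And>l. J l \<in> atoms (M l) \<and> x $ l \<in> J l" by metis
  then have "cart_box J \<in> atoms (prod_sigma_algebra a b M)" "x \<in> cart_box J"
    unfolding atoms_prod_sigma_algebra[OF M] by (auto simp: cart_box_def)
  then show ?thesis using that by blast
qed

lemma prod_atom_subset_cube:
  fixes M :: "'n::finite \<Rightarrow> real set set"
  assumes M: "\<And>l. interval_sigma_algebra a b (M l)" and A: "A \<in> atoms (prod_sigma_algebra a b M)"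
  shows "A \<subseteq> cube a b"
proof -
  obtain J where J: "A = cart_box J" "\<And>l. J l \<in> atoms (M l)" "\<And>l. (\<lambda>x. x $ l) ` A = J l"
    using cart_box_atom_cases[OF M A] by metis
  show ?thesis unfolding J(1) cube_def cart_box_def using atom_subset_Ioc[OF M J(2)] by blast
qed

lemma prod_atoms_refine:
  fixes M N :: "'n::finite \<Rightarrow> real set set"
  assumes M: "\<And>l. interval_sigma_algebra a b (M l)" and N: "\<And>l. interval_sigma_algebra a b (N l)"
    and MN: "\<And>l. M l \<subseteq> N l"
    and A: "A \<in> atoms (prod_sigma_algebra a b N)" and B: "B \<in> atoms (prod_sigma_algebra a b M)"
  shows "A \<subseteq> B \<or> A \<inter> B = {}"
proof -
  obtain J where J: "A = cart_box J" "\<And>l. J l \<in> atoms (N l)"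
    using cart_box_atom_cases[OF N A] by metis
  obtain K where K: "B = cart_box K" "\<And>l. K l \<in> atoms (M l)"
    using cart_box_atom_cases[OF M B] by metis
  show ?thesis
    using fine_atom_subset_or_disjoint[OF M N MN J(2) K(2)] unfolding J(1) K(1) cart_box_def by blast
qed

lemma prod_atoms_eq_if_common_point:
  fixes M :: "'n::finite \<Rightarrow> real set set"
  assumes M: "\<And>l. interval_sigma_algebra a b (M l)"
    and A: "A \<in> atoms (prod_sigma_algebra a b M)" and B: "B \<in> atoms (prod_sigma_algebra a b M)"
    and x: "x \<in> A" "x \<in> B"
  shows "A = B"
  using prod_atoms_refine[OF M M _ A B] prod_atoms_refine[OF M M _ B A] x by blast

lemma finite_prod_atoms:
  fixes M :: "'n::finite \<Rightarrow> real set set"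
  assumes M: "\<And>l. interval_sigma_algebra a b (M l)"
  shows "finite (atoms (prod_sigma_algebra a b M))"
proof -
  have "atoms (prod_sigma_algebra a b M) = cart_box ` (\<Pi>\<^sub>E l\<in>UNIV. atoms (M l))"
    unfolding atoms_prod_sigma_algebra[OF M] by (auto simp: PiE_UNIV_domain)
  moreover have "finite (\<Pi>\<^sub>E l\<in>UNIV. atoms (M l))"
    using interval_sigma_algebra_atoms(1)[OF M] by (intro finite_PiE) auto
  ultimately show ?thesis by simp
qed

lemma atom_at_prod:
  fixes M :: "'n::finite \<Rightarrow> real set set"
  assumes M: "\<And>l. interval_sigma_algebra a b (M l)"
    and A: "A \<in> atoms (prod_sigma_algebra a b M)" "x \<in> A"
  shows "atom_at (prod_sigma_algebra a b M) x = A"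
  unfolding atom_at_def
proof (rule the_equality)
  fix B assume "B \<in> atoms (prod_sigma_algebra a b M) \<and> x \<in> B"
  then show "B = A" using prod_atoms_eq_if_common_point[OF M _ A(1) _ A(2)] by blast
qed (use A in blast)

text \<open>Allows sums over atoms to be rewritten as sums over offsets.\<close>

lemma inj_on_multi_index:
  fixes M :: "'n::finite \<Rightarrow> real set set"
  assumes M: "\<And>l. interval_sigma_algebra a b (M l)"
  shows "inj_on (multi_index M) (atoms (prod_sigma_algebra a b M))"
proof (rule inj_onI)
  fix A B assume A: "A \<in> atoms (prod_sigma_algebra a b M)"
    and B: "B \<in> atoms (prod_sigma_algebra a b M)" and eq: "multi_index M A = multi_index M B"
  obtain J where J: "A = cart_box J" "\<And>l. J l \<in> atoms (M l)" "\<And>l. (\<lambda>x. x $ l) ` A = J l"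
    using cart_box_atom_cases[OF M A] by metis
  obtain x y where xy: "x \<in> A" "y \<in> B" using A B by (fastforce simp: atoms_def)
  have "y $ l \<in> J l" for l
  proof (rule same_atom_if_endpoint_count_eq[OF M J(2)])
    show "x $ l \<in> J l" using J(3) xy by blast
    show "y $ l \<in> {a<..b}"
      using prod_atom_subset_cube[OF M B] xy unfolding cube_def cart_box_def by blast
    show "endpoint_count (M l) (x $ l) = endpoint_count (M l) (y $ l)"
      using multi_index_eq_endpoint_count[OF M A xy(1)] multi_index_eq_endpoint_count[OF M B xy(2)] eq
      by (metis of_nat_eq_iff)
  qed
  then have "y \<in> A" unfolding J(1) cart_box_def by blast
  then show "A = B" using prod_atoms_eq_if_common_point[OF M A B] xy by blast
qed

text \<open>Refining the partitions can only increase the index distance between two points. Hence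
  at a later time an atom with the same offset from a smaller \<open>B'\<close> cannot leave \<open>re (A \<union> B)\<close>.\<close>

lemma fine_shift_subset_re:
  fixes M N :: "'n::finite \<Rightarrow> real set set"
  assumes M: "\<And>l. interval_sigma_algebra a b (M l)" and N: "\<And>l. interval_sigma_algebra a b (N l)"
    and MN: "\<And>l. M l \<subseteq> N l"
    and A: "A \<in> atoms (prod_sigma_algebra a b M)" and B: "B \<in> atoms (prod_sigma_algebra a b M)"
    and A': "A' \<in> atoms (prod_sigma_algebra a b N)" and B': "B' \<in> atoms (prod_sigma_algebra a b N)"
    and eq: "\<And>l. multi_index N A' l - multi_index N B' l = multi_index M A l - multi_index M B l"
    and sub: "B' \<subseteq> B"
  shows "A' \<subseteq> re (A \<union> B)"
proof
  fix x assume x: "x \<in> A'"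
  \<comment> \<open>A point common to \<open>B'\<close> and \<open>B\<close> serves as the reference
    point at both levels.\<close>
  obtain y where y: "y \<in> B'" "y \<in> B" using B' sub by (fastforce simp: atoms_def)
  obtain x' where x': "x' \<in> A" using A by (fastforce simp: atoms_def)
  obtain K where K: "\<And>l. K l \<in> atoms (M l)" "\<And>l. (\<lambda>x. x $ l) ` A = K l"
    using cart_box_atom_cases[OF M A] by metis
  have "x \<in> cart_box J" if J: "\<And>l. is_interval (J l)" and AB: "A \<union> B \<subseteq> cart_box J" for J
  proof -
    have "x $ l \<in> J l" for l
    proof (rule between_if_same_endpoint_count_diff[OF M N MN K(1)])
      show "x' $ l \<in> K l" using K(2) x' by blast
      show "x $ l \<in> {a<..b}"
        using prod_atom_subset_cube[OF N A'] x unfolding cube_def cart_box_def by blast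
      show "int (endpoint_count (N l) (x $ l)) - int (endpoint_count (N l) (y $ l))
          = int (endpoint_count (M l) (x' $ l)) - int (endpoint_count (M l) (y $ l))"
        using eq[of l] multi_index_eq_endpoint_count[OF M A x'] multi_index_eq_endpoint_count[OF M B y(2)]
          multi_index_eq_endpoint_count[OF N A' x] multi_index_eq_endpoint_count[OF N B' y(1)] by simp
      show "is_interval (J l)" by (rule J)
      show "K l \<subseteq> J l" using AB unfolding K(2)[symmetric] cart_box_def by blast
      show "y $ l \<in> J l" using AB y unfolding cart_box_def by blast
    qed
    then show ?thesis unfolding cart_box_def by blast
  qed
  then show "x \<in> re (A \<union> B)" unfolding re_def hull_def rectangle_def by blast
qed

section \<open>Measurability of rectangles and atoms\<close>

lemma convex_rectangle: "rectangle R \<Longrightarrow> convex R"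
  unfolding rectangle_def cart_box_def convex_alt is_interval_convex_1 by fastforce

lemma rectangle_cube: "rectangle (cube a b)"
  unfolding rectangle_def cube_def by (intro exI[of _ "\<lambda>_. {a<..b}"]) (simp add: is_interval_oc)

lemma bounded_cube: "bounded (cube a b :: (real^'n::finite) set)"
proof (rule bounded_subset)
  show "(cube a b :: (real^'n) set) \<subseteq> cbox (\<chi> _. a) (\<chi> _. b)"
    unfolding cube_def cart_box_def mem_box_cart by (auto simp: mem_box_cart less_imp_le)
qed simp

text \<open>The hull is an intersection of convex sets, and it is bounded because the cube is itself
  one of the rectangles containing \<open>S\<close>.\<close>

lemma re_lmeasurable:
  fixes S :: "(real^'n::finite) set"
  assumes "S \<subseteq> cube a b"
  shows "re S \<in> lmeasurable"
proof (rule measurable_convex)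
  show "convex (re S)" unfolding re_def hull_def by (intro convex_Inter) (auto intro: convex_rectangle)
  have "re S \<subseteq> cube a b"
    unfolding re_def hull_def using assms rectangle_cube by blast
  then show "bounded (re S)" using bounded_cube bounded_subset by blast
qed

lemma cube_lmeasurable: "(cube a b :: (real^'n::finite) set) \<in> lmeasurable"
  by (intro measurable_convex convex_rectangle rectangle_cube bounded_cube)

lemma prod_atom_lmeasurable:
  fixes M :: "'n::finite \<Rightarrow> real set set"
  assumes M: "\<And>l. interval_sigma_algebra a b (M l)" and A: "A \<in> atoms (prod_sigma_algebra a b M)"
  shows "A \<in> lmeasurable"
proof (rule measurable_convex)
  obtain J where J: "A = cart_box J" "\<And>l. J l \<in> atoms (M l)" "\<And>l. (\<lambda>x. x $ l) ` A = J l"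
    using cart_box_atom_cases[OF M A] by metis
  have "is_interval (J l)" for l
    using interval_sigma_algebra_atoms(4)[OF M J(2)] by (metis is_interval_oc)
  then show "convex A" using convex_rectangle J(1) unfolding rectangle_def by blast
  show "bounded A" using prod_atom_subset_cube[OF M A] bounded_cube bounded_subset by blast
qed

section \<open>The covering argument in abstract form\<close>

text \<open>A Vitali-type selection in which \<open>absorb\<close> replaces the dilation of the
  selected sets, so no constant is lost. Every \<open>A\<close> is covered by some
  \<open>R A' B'\<close> with \<open>B'\<close> selected, and the selected \<open>B'\<close> are
  disjoint, so their integrals add up to at most the integral over \<open>\<Omega>\<close>.\<close>

lemma covering_bound:
  fixes T :: "(nat \<times> 'a set \<times> 'a set) set" and R :: "'a set \<Rightarrow> 'a set \<Rightarrow> 'a set"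
  assumes "finite T" "s > 0" and g: "set_integrable M \<Omega> g" "\<And>x. g x \<ge> (0::real)"
    and \<Omega>: "\<Omega> \<in> sets M"
    and A: "\<And>n A B. (n, A, B) \<in> T \<Longrightarrow> A \<in> sets M"
    and B: "\<And>n A B. (n, A, B) \<in> T \<Longrightarrow> B \<in> sets M \<and> B \<subseteq> \<Omega>"
    and R: "\<And>n A B. (n, A, B) \<in> T \<Longrightarrow> R A B \<in> fmeasurable M"
    and weight: "\<And>n A B. (n, A, B) \<in> T \<Longrightarrow> s * measure M (R A B) \<le> (LINT y:B|M. g y)"
    and nested: "\<And>n A B n' A' B'. (n, A, B) \<in> T \<Longrightarrow> (n', A', B') \<in> T \<Longrightarrow> n \<le> n' \<Longrightarrow> B' \<subseteq> B \<or> B' \<inter> B = {}"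
    and absorb: "\<And>n A B n' A' B'. (n, A, B) \<in> T \<Longrightarrow> (n', A', B') \<in> T \<Longrightarrow> n \<le> n' \<Longrightarrow> B' \<subseteq> B
      \<Longrightarrow> A' \<subseteq> R A B"
  shows "measure M (\<Union>(n, A, B)\<in>T. A) \<le> (LINT y:\<Omega>|M. g y) / s"
proof -
  \<comment> \<open>A triple is kept when no set of the family containing \<open>B\<close> occurs at
    an earlier time.\<close>
  define U where "U = {(n, A, B). (n, A, B) \<in> T \<and> (\<forall>n' A' B'. (n', A', B') \<in> T \<longrightarrow> B \<subseteq> B' \<longrightarrow> n \<le> n')}"
  define \<B> where "\<B> = {B. \<exists>n A. (n, A, B) \<in> U}"
  \<comment> \<open>Several \<open>A\<close> may be paired with the same \<open>B\<close>; one
    choice per \<open>B\<close> is enough for the cover.\<close>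
  have "\<forall>B\<in>\<B>. \<exists>n A. (n, A, B) \<in> U" unfolding \<B>_def by blast
  then obtain nn AA where sel: "\<And>B. B \<in> \<B> \<Longrightarrow> (nn B, AA B, B) \<in> U" by metis
  have UT: "U \<subseteq> T" unfolding U_def by blast
  have selT: "(nn B, AA B, B) \<in> T" if "B \<in> \<B>" for B using sel[OF that] UT by blast
  have fin: "finite \<B>"
    by (rule finite_subset[of _ "(\<lambda>(n, A, B). B) ` T"]) (use \<open>finite T\<close> UT in \<open>auto simp: \<B>_def image_iff\<close>)
  have cover: "(\<Union>(n, A, B)\<in>T. A) \<subseteq> (\<Union>B\<in>\<B>. R (AA B) B)"
  proof
    fix x assume "x \<in> (\<Union>(n, A, B)\<in>T. A)"
    then obtain n A B where nAB: "(n, A, B) \<in> T" "x \<in> A" by blast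
    \<comment> \<open>The earliest time at which some set contains \<open>B\<close> yields a
      selected \<open>B'\<close>, since every superset of \<open>B'\<close> is also a superset of
      \<open>B\<close>.\<close>
    define P where "P m \<longleftrightarrow> (\<exists>A' B'. (m, A', B') \<in> T \<and> B \<subseteq> B')" for m
    have "P n" unfolding P_def using nAB by blast
    then have "P (Least P)" "Least P \<le> n" by (auto intro: LeastI Least_le)
    then obtain A' B' where T': "(Least P, A', B') \<in> T" "B \<subseteq> B'" unfolding P_def by blast
    have "Least P \<le> m" if "(m, A'', B'') \<in> T" "B' \<subseteq> B''" for m A'' B''
      using that T' unfolding P_def by (intro Least_le) blast
    then have U': "(Least P, A', B') \<in> U" unfolding U_def using T' by blast
    then have B': "B' \<in> \<B>" unfolding \<B>_def by blast
    have "nn B' \<le> Least P" using sel[OF B'] T'(1) unfolding U_def by blast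
    then have "A \<subseteq> R (AA B') B'"
      using absorb[OF selT[OF B'] nAB(1) _ T'(2)] \<open>Least P \<le> n\<close> by simp
    then show "x \<in> (\<Union>B\<in>\<B>. R (AA B) B)" using nAB B' by blast
  qed
  have disj: "disjoint_family_on (\<lambda>B. B) \<B>"
    unfolding disjoint_family_on_def
  proof (intro ballI impI)
    \<comment> \<open>Nestedness gives \<open>C \<subseteq> B\<close>; the time minimality of
      \<open>C\<close> then makes the times equal, and nestedness applies in the other
      direction.\<close>
    have *: "B = C" if "B \<in> \<B>" "C \<in> \<B>" "nn B \<le> nn C" "B \<inter> C \<noteq> {}" for B C
    proof -
      have "C \<subseteq> B" using nested[OF selT[OF that(1)] selT[OF that(2)]] that by blast
      then have "nn C \<le> nn B" using sel[OF that(2)] selT[OF that(1)] unfolding U_def by blast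
      then have "B \<subseteq> C" using nested[OF selT[OF that(2)] selT[OF that(1)]] that by blast
      then show ?thesis using \<open>C \<subseteq> B\<close> by blast
    qed
    fix B C assume "B \<in> \<B>" "C \<in> \<B>" "B \<noteq> C"
    then show "B \<inter> C = {}" using *[of B C] *[of C B] by (cases "nn B \<le> nn C") auto
  qed
  have int: "set_integrable M B g" if "B \<in> \<B>" for B
    using set_integrable_subset[OF g(1)] B[OF selT[OF that]] by blast
  have Usets: "(\<Union>B\<in>\<B>. B) \<in> sets M" "(\<Union>B\<in>\<B>. B) \<subseteq> \<Omega>" using B[OF selT] fin by blast+
  have "measure M (\<Union>(n, A, B)\<in>T. A) \<le> measure M (\<Union>B\<in>\<B>. R (AA B) B)"
  proof (rule measure_mono_fmeasurable[OF cover])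
    show "(\<Union>(n, A, B)\<in>T. A) \<in> sets M" using \<open>finite T\<close> A by (intro sets.finite_UN) auto
    show "(\<Union>B\<in>\<B>. R (AA B) B) \<in> fmeasurable M"
      using fin R[OF selT] by (intro fmeasurable.finite_UN) auto
  qed
  also have "\<dots> \<le> (\<Sum>B\<in>\<B>. measure M (R (AA B) B))"
    using fin R[OF selT] by (intro measure_UNION_le) auto
  also have "\<dots> \<le> (\<Sum>B\<in>\<B>. (LINT y:B|M. g y) / s)"
    using weight[OF selT] \<open>s > 0\<close> by (intro sum_mono) (simp add: field_simps)
  also have "\<dots> = (\<Sum>B\<in>\<B>. (LINT y:B|M. g y)) / s" by (simp add: sum_divide_distrib)
  also have "(\<Sum>B\<in>\<B>. (LINT y:B|M. g y)) = (LINT y:(\<Union>B\<in>\<B>. B)|M. g y)"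
    using fin int B[OF selT] disj by (subst set_integral_finite_Union[where A="\<lambda>B. B"]) auto
  also have "\<dots> \<le> (LINT y:\<Omega>|M. g y)"
    using g(2) Usets(2) set_integrable_subset[OF g(1) Usets] g(1)
    unfolding set_lebesgue_integral_def set_integrable_def
    by (intro integral_mono) (auto simp: indicator_def)
  finally show ?thesis using \<open>s > 0\<close> by (simp add: divide_right_mono)
qed

section \<open>Geometric sums over offsets\<close>

text \<open>The nonnegative and the nonpositive half each contribute a geometric series; counting 0
  twice only weakens the bound.\<close>

lemma sum_power_abs_le:
  fixes r :: real
  assumes "0 < r" "r < 1"
  shows "(\<Sum>i\<in>{-int N..int N}. r ^ nat \<bar>i\<bar>) \<le> 2 / (1 - r)"
proof -
  have geo: "(\<Sum>j\<le>N. r ^ j) \<le> 1 / (1 - r)"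
    using assms by (subst sum_gp0) (simp add: divide_right_mono)
  have "(\<Sum>i\<in>{-int N..int N}. r ^ nat \<bar>i\<bar>)
      \<le> (\<Sum>i\<in>int ` {..N} \<union> (\<lambda>j. - int j) ` {..N}. r ^ nat \<bar>i\<bar>)"
  proof (rule sum_mono2)
    show "{-int N..int N} \<subseteq> int ` {..N} \<union> (\<lambda>j. - int j) ` {..N}"
    proof
      fix i assume i: "i \<in> {-int N..int N}"
      show "i \<in> int ` {..N} \<union> (\<lambda>j. - int j) ` {..N}"
      proof (cases "i \<ge> 0")
        case True
        then have "i = int (nat i)" "nat i \<in> {..N}" using i by auto
        then show ?thesis by blast
      next
        case False
        then have "i = - int (nat (- i))" "nat (- i) \<in> {..N}" using i by auto
        then show ?thesis by blast
      qed
    qed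
  qed (use assms in auto)
  also have "\<dots> \<le> (\<Sum>i\<in>int ` {..N}. r ^ nat \<bar>i\<bar>) + (\<Sum>i\<in>(\<lambda>j. - int j) ` {..N}. r ^ nat \<bar>i\<bar>)"
    using assms by (subst sum.union_inter[symmetric]) (auto intro!: sum_nonneg)
  also have "\<dots> = (\<Sum>j\<le>N. r ^ j) + (\<Sum>j\<le>N. r ^ j)"
    by (simp add: sum.reindex inj_on_def)
  also have "\<dots> \<le> 2 / (1 - r)" using geo by simp
  finally show ?thesis .
qed

text \<open>After enlarging \<open>K\<close> to a box, the sum factors into one-dimensional sums.
  The bound is independent of \<open>K\<close>.\<close>

lemma sum_power_l1_le:
  fixes r :: real and K :: "('n::finite \<Rightarrow> int) set"
  assumes "0 < r" "r < 1" "finite K"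
  shows "(\<Sum>k\<in>K. r ^ nat (\<Sum>l\<in>UNIV. \<bar>k l\<bar>)) \<le> (2 / (1 - r)) ^ CARD('n)"
proof -
  have fin: "finite (\<Union>k\<in>K. range (\<lambda>l. nat \<bar>k l\<bar>))" using assms(3) by auto
  obtain N where N: "\<And>k l. k \<in> K \<Longrightarrow> nat \<bar>k l\<bar> \<le> N"
    using finite_nat_set_iff_bounded_le[THEN iffD1, OF fin] by blast
  have *: "r ^ nat (\<Sum>l\<in>UNIV. \<bar>k l\<bar>) = (\<Prod>l\<in>UNIV. r ^ nat \<bar>k l\<bar>)" for k :: "'n \<Rightarrow> int"
  proof -
    have "nat (\<Sum>l\<in>UNIV. \<bar>k l\<bar>) = (\<Sum>l\<in>UNIV. nat \<bar>k l\<bar>)"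
      by (simp add: nat_eq_iff sum_nonneg)
    then show ?thesis by (simp add: power_sum)
  qed
  have "(\<Sum>k\<in>K. r ^ nat (\<Sum>l\<in>UNIV. \<bar>k l\<bar>)) \<le> (\<Sum>k\<in>(\<Pi>\<^sub>E l\<in>(UNIV::'n set). {-int N..int N}). r ^ nat (\<Sum>l\<in>UNIV. \<bar>k l\<bar>))"
  proof (rule sum_mono2)
    show "finite (\<Pi>\<^sub>E l\<in>(UNIV::'n set). {-int N..int N})" by (intro finite_PiE) auto
    show "K \<subseteq> (\<Pi>\<^sub>E l\<in>UNIV. {-int N..int N})"
    proof
      fix k assume "k \<in> K"
      then have "\<bar>k l\<bar> \<le> int N" for l using N[of k l] by simp
      then have "k l \<in> {-int N..int N}" for l by (simp add: abs_le_iff minus_le_iff)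
      then show "k \<in> (\<Pi>\<^sub>E l\<in>UNIV. {-int N..int N})" by (simp add: PiE_UNIV_domain)
    qed
  qed (use assms in auto)
  also have "\<dots> = (\<Prod>l\<in>(UNIV::'n set). \<Sum>i\<in>{-int N..int N}. r ^ nat \<bar>i\<bar>)"
    unfolding * by (subst prod_sum_PiE) auto
  also have "\<dots> = (\<Sum>i\<in>{-int N..int N}. r ^ nat \<bar>i\<bar>) ^ CARD('n)" by simp
  also have "\<dots> \<le> (2 / (1 - r)) ^ CARD('n)"
    using sum_power_abs_le[OF assms(1,2)] assms by (intro power_mono sum_nonneg) auto
  finally show ?thesis .
qed

section \<open>Weak-type bound for a fixed offset\<close>

lemma interval_filtration_level:
  assumes "interval_filtration a b F" "n \<ge> 1"
  shows "interval_sigma_algebra a b (F n l)"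
  using assms unfolding interval_filtration_def by blast

lemma interval_filtration_mono:
  assumes "interval_filtration a b F" "1 \<le> m" "m \<le> n"
  shows "F m l \<subseteq> F n l"
  using assms unfolding interval_filtration_def by blast

text \<open>\<open>A\<close> is the atom of the point and \<open>B\<close> carries the mass. The
  cutoff \<open>N\<close> keeps the set finite.\<close>

definition heavy_pairs ::
  "real \<Rightarrow> real \<Rightarrow> (nat \<Rightarrow> 'n::finite \<Rightarrow> real set set) \<Rightarrow> (real^'n \<Rightarrow> real) \<Rightarrow> nat \<Rightarrow> real \<Rightarrow> ('n \<Rightarrow> int)
    \<Rightarrow> (nat \<times> (real^'n) set \<times> (real^'n) set) set" where
  "heavy_pairs a b F f N s k = {(n, A, B). n \<in> {1..N} \<and>
     A \<in> atoms (prod_sigma_algebra a b (F n)) \<and> B \<in> atoms (prod_sigma_algebra a b (F n)) \<and>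
     (\<forall>l. multi_index (F n) B l - multi_index (F n) A l = k l) \<and>
     s * measure lebesgue (re (B \<union> A)) < (LINT y:B|lebesgue. \<bar>f y\<bar>)}"

lemma finite_heavy_pairs:
  assumes F: "interval_filtration a b F"
  shows "finite (heavy_pairs a b F f N s k)"
proof (rule finite_subset)
  let ?P = "\<lambda>n. atoms (prod_sigma_algebra a b (F n))"
  show "heavy_pairs a b F f N s k \<subseteq> (SIGMA n:{1..N}. ?P n \<times> ?P n)"
    unfolding heavy_pairs_def by auto
  show "finite (SIGMA n:{1..N}. ?P n \<times> ?P n)"
    using finite_prod_atoms[OF interval_filtration_level[OF F]] by (intro finite_SigmaI) auto
qed

text \<open>Since all pairs share the offset \<open>k\<close>, \<open>fine_shift_subset_re\<close>
  supplies the absorption required by \<open>covering_bound\<close>. The bound depends neither on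
  \<open>k\<close> nor on \<open>N\<close>.\<close>

lemma heavy_pairs_weak_type:
  fixes F :: "nat \<Rightarrow> 'n::finite \<Rightarrow> real set set"
  assumes F: "interval_filtration a b F" and f: "set_integrable lebesgue (cube a b) f" and "s > 0"
  shows "measure lebesgue (\<Union>(n, A, B)\<in>heavy_pairs a b F f N s k. A)
    \<le> (LINT y:cube a b|lebesgue. \<bar>f y\<bar>) / s"
proof (rule covering_bound[where R="\<lambda>A B. re (B \<union> A)"])
  note isa = interval_filtration_level[OF F]
  show "finite (heavy_pairs a b F f N s k)" by (rule finite_heavy_pairs[OF F])
  show "set_integrable lebesgue (cube a b) (\<lambda>y. \<bar>f y\<bar>)" using f by (rule set_integrable_abs)
  show "cube a b \<in> sets lebesgue" using cube_lmeasurable by blast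
  fix n A B assume T: "(n, A, B) \<in> heavy_pairs a b F f N s k"
  then have n: "n \<ge> 1" and A: "A \<in> atoms (prod_sigma_algebra a b (F n))"
    and B: "B \<in> atoms (prod_sigma_algebra a b (F n))"
    and k: "\<And>l. multi_index (F n) B l - multi_index (F n) A l = k l"
    unfolding heavy_pairs_def by auto
  have sub: "A \<subseteq> cube a b" "B \<subseteq> cube a b"
    by (rule prod_atom_subset_cube[OF isa[OF n] A], rule prod_atom_subset_cube[OF isa[OF n] B])
  show "A \<in> sets lebesgue" using prod_atom_lmeasurable[OF isa[OF n] A] by blast
  show "B \<in> sets lebesgue \<and> B \<subseteq> cube a b" using prod_atom_lmeasurable[OF isa[OF n] B] sub by blast
  show "re (B \<union> A) \<in> lmeasurable" using sub by (intro re_lmeasurable[of _ a b]) blast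
  show "s * measure lebesgue (re (B \<union> A)) \<le> (LINT y:B|lebesgue. \<bar>f y\<bar>)"
    using T unfolding heavy_pairs_def by auto
  fix n' A' B' assume T': "(n', A', B') \<in> heavy_pairs a b F f N s k" and le: "n \<le> n'"
  then have n': "n' \<ge> 1" and A': "A' \<in> atoms (prod_sigma_algebra a b (F n'))"
    and B': "B' \<in> atoms (prod_sigma_algebra a b (F n'))"
    and k': "\<And>l. multi_index (F n') B' l - multi_index (F n') A' l = k l"
    unfolding heavy_pairs_def by auto
  note mono = interval_filtration_mono[OF F n le]
  show "B' \<subseteq> B \<or> B' \<inter> B = {}" by (rule prod_atoms_refine[OF isa[OF n] isa[OF n'] mono B' B])
  assume sub': "B' \<subseteq> B"
  have "multi_index (F n') A' l - multi_index (F n') B' l = multi_index (F n) A l - multi_index (F n) B l" for l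
    using k[of l] k'[of l] by linarith
  then have "A' \<subseteq> re (A \<union> B)"
    by (intro fine_shift_subset_re[OF isa[OF n] isa[OF n'] mono A B A' B' _ sub'])
  then show "A' \<subseteq> re (B \<union> A)" by (simp add: Un_commute)
qed (use \<open>s > 0\<close> in auto)

section \<open>Summation over the offsets\<close>

text \<open>One level of \<open>maximal_fun\<close> depends only on the atom of the point, here
  called \<open>B\<close>. As in \<open>maximal_fun\<close>, \<open>A\<close> runs through the atoms
  carrying mass, so the letters are swapped compared with \<open>heavy_pairs\<close>.\<close>

definition weighted_avg ::
  "real \<Rightarrow> real \<Rightarrow> real \<Rightarrow> ('n::finite \<Rightarrow> real set set) \<Rightarrow> (real^'n \<Rightarrow> real) \<Rightarrow> (real^'n) set \<Rightarrow> real" where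
  "weighted_avg q a b M f B = (\<Sum>A\<in>atoms (prod_sigma_algebra a b M).
     q ^ atom_dist M A B / measure lebesgue (re (A \<union> B)) * (LINT y:A|lebesgue. \<bar>f y\<bar>))"

text \<open>Pigeonhole: if no atom were heavy, the terms would be at most
  \<open>t / S * r ^ d\<close> with \<open>d\<close> the atom distance, and would sum to at most
  \<open>t\<close>. Of the two factors \<open>r ^ d\<close> bounding \<open>q ^ d\<close>, one
  cancels the threshold and the other makes the sum converge.\<close>

lemma heavy_atom_if_weighted_avg_gt:
  fixes M :: "'n::finite \<Rightarrow> real set set"
  assumes M: "\<And>l. interval_sigma_algebra a b (M l)"
    and q: "0 \<le> q" "q \<le> r\<^sup>2" and r: "0 < r" "r < 1" and t: "t > 0"
    and S: "S = (2 / (1 - r)) ^ CARD('n)" and gt: "weighted_avg q a b M f A > t"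
  shows "\<exists>B\<in>atoms (prod_sigma_algebra a b M).
    t / (S * r ^ atom_dist M B A) * measure lebesgue (re (B \<union> A)) < (LINT y:B|lebesgue. \<bar>f y\<bar>)"
proof (rule ccontr)
  let ?P = "atoms (prod_sigma_algebra a b M)"
  assume "\<not> ?thesis"
  then have le: "(LINT y:B|lebesgue. \<bar>f y\<bar>) \<le> t / (S * r ^ atom_dist M B A) * measure lebesgue (re (B \<union> A))"
    if "B \<in> ?P" for B using that by (meson not_less)
  have "S > 0" using r S by simp
  have "weighted_avg q a b M f A \<le> (\<Sum>B\<in>?P. t / S * r ^ atom_dist M B A)"
    unfolding weighted_avg_def
  proof (rule sum_mono)
    fix B assume B: "B \<in> ?P"
    let ?d = "atom_dist M B A" and ?m = "measure lebesgue (re (B \<union> A))"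
    have "q ^ ?d / ?m * (LINT y:B|lebesgue. \<bar>f y\<bar>) \<le> q ^ ?d / ?m * (t / (S * r ^ ?d) * ?m)"
      using le[OF B] q by (intro mult_left_mono) auto
    \<comment> \<open>If \<open>?m = 0\<close>, the left side is 0 because division by zero gives
      0.\<close>
    also have "\<dots> \<le> q ^ ?d * (t / (S * r ^ ?d))"
      using q t r \<open>S > 0\<close> by (cases "?m = 0") auto
    also have "\<dots> \<le> (r\<^sup>2) ^ ?d * (t / (S * r ^ ?d))"
      using q t r \<open>S > 0\<close> by (intro mult_right_mono power_mono) auto
    also have "\<dots> = t / S * r ^ ?d"
      using r \<open>S > 0\<close> by (simp add: field_simps power2_eq_square power_mult_distrib)
    finally show "q ^ ?d / ?m * (LINT y:B|lebesgue. \<bar>f y\<bar>) \<le> t / S * r ^ ?d" .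
  qed
  also have "\<dots> = t / S * (\<Sum>B\<in>?P. r ^ atom_dist M B A)" by (simp add: sum_distrib_left)
  also have "(\<Sum>B\<in>?P. r ^ atom_dist M B A)
      = (\<Sum>k\<in>(\<lambda>B l. multi_index M B l - multi_index M A l) ` ?P. r ^ nat (\<Sum>l\<in>UNIV. \<bar>k l\<bar>))"
  proof (subst sum.reindex)
    show "inj_on (\<lambda>B l. multi_index M B l - multi_index M A l) ?P"
      using inj_on_multi_index[of a b M] M by (simp add: inj_on_def fun_eq_iff)
  qed (simp add: atom_dist_def)
  also have "t / S * \<dots> \<le> t / S * S"
    unfolding S by (intro mult_left_mono sum_power_l1_le[OF r])
      (use finite_prod_atoms[of a b M] M t r in auto)
  finally show False using gt \<open>S > 0\<close> by simp
qed

text \<open>Writes the level set as a union of atoms, from which its measurability follows.\<close>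

lemma weighted_avg_level_set:
  fixes M :: "'n::finite \<Rightarrow> real set set"
  assumes M: "\<And>l. interval_sigma_algebra a b (M l)"
  shows "{x \<in> cube a b. weighted_avg q a b M f (atom_at (prod_sigma_algebra a b M) x) > t}
    = \<Union>{A \<in> atoms (prod_sigma_algebra a b M). weighted_avg q a b M f A > t}"
proof (intro equalityI subsetI)
  fix x assume x: "x \<in> {x \<in> cube a b. weighted_avg q a b M f (atom_at (prod_sigma_algebra a b M) x) > t}"
  then obtain A where A: "A \<in> atoms (prod_sigma_algebra a b M)" "x \<in> A"
    using prod_atom_ex[of a b M x, OF M] by blast
  then show "x \<in> \<Union>{A \<in> atoms (prod_sigma_algebra a b M). weighted_avg q a b M f A > t}"
    using x atom_at_prod[OF M A] by auto
next
  fix x assume "x \<in> \<Union>{A \<in> atoms (prod_sigma_algebra a b M). weighted_avg q a b M f A > t}"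
  then obtain A where A: "A \<in> atoms (prod_sigma_algebra a b M)" "x \<in> A" "weighted_avg q a b M f A > t"
    by blast
  then show "x \<in> {x \<in> cube a b. weighted_avg q a b M f (atom_at (prod_sigma_algebra a b M) x) > t}"
    using atom_at_prod[OF M A(1,2)] prod_atom_subset_cube[OF M A(1)] by auto
qed

text \<open>Offset \<open>k\<close> has the threshold \<open>t / (S * r ^ |k|)\<close> and so
  contributes at most \<open>S * r ^ |k| / t\<close> times the norm of \<open>f\<close>. Summing
  over \<open>k\<close> gives the second factor \<open>S\<close>.\<close>

lemma finite_levels_weak_type:
  fixes F :: "nat \<Rightarrow> 'n::finite \<Rightarrow> real set set"
  assumes F: "interval_filtration a b F" and f: "set_integrable lebesgue (cube a b) f"
    and q: "0 \<le> q" "q \<le> r\<^sup>2" and r: "0 < r" "r < 1" and t: "t > 0"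
    and S: "S = (2 / (1 - r)) ^ CARD('n)"
    and E: "E = (\<Union>n\<in>{1..N}. \<Union>{A \<in> atoms (prod_sigma_algebra a b (F n)). weighted_avg q a b (F n) f A > t})"
  shows "E \<in> lmeasurable" "measure lebesgue E \<le> S\<^sup>2 / t * (LINT y:cube a b|lebesgue. \<bar>f y\<bar>)"
proof -
  note isa = interval_filtration_level[OF F]
  let ?P = "\<lambda>n. atoms (prod_sigma_algebra a b (F n))"
  let ?H = "\<lambda>k. heavy_pairs a b F f N (t / (S * r ^ nat (\<Sum>l\<in>UNIV. \<bar>k l\<bar>))) k"
  let ?V = "\<lambda>k. \<Union>(n, A, B)\<in>?H k. A"
  \<comment> \<open>Only finitely many offsets occur up to level \<open>N\<close>, so finite
    subadditivity suffices.\<close>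
  define K where "K = (\<Union>n\<in>{1..N}. (\<lambda>(A, B) l. multi_index (F n) B l - multi_index (F n) A l) ` (?P n \<times> ?P n))"
  have "S > 0" using r S by simp
  have finP: "finite (?P n)" if "n \<ge> 1" for n using finite_prod_atoms[OF isa[OF that]] .
  have finK: "finite K" unfolding K_def using finP by auto
  have atom: "A \<in> lmeasurable" if "n \<ge> 1" "A \<in> ?P n" for n A
    using prod_atom_lmeasurable[OF isa[OF that(1)] that(2)] .
  show E_meas: "E \<in> lmeasurable"
    unfolding E using finP atom by (intro fmeasurable.finite_UN fmeasurable.finite_Union) auto
  have V_meas: "?V k \<in> lmeasurable" for k
  proof (rule fmeasurable.finite_UN)
    show "finite (?H k)" by (rule finite_heavy_pairs[OF F])
  qed (use atom in \<open>auto simp: heavy_pairs_def\<close>)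
  have "E \<subseteq> (\<Union>k\<in>K. ?V k)"
  proof
    fix x assume "x \<in> E"
    then obtain n A where n: "n \<in> {1..N}" and A: "A \<in> ?P n" "x \<in> A"
      and gt: "weighted_avg q a b (F n) f A > t" unfolding E by blast
    have n1: "n \<ge> 1" using n by simp
    obtain B where B: "B \<in> ?P n" "t / (S * r ^ atom_dist (F n) B A) * measure lebesgue (re (B \<union> A))
        < (LINT y:B|lebesgue. \<bar>f y\<bar>)"
      using heavy_atom_if_weighted_avg_gt[OF isa[OF n1] q r t S gt] by blast
    define k where "k l = multi_index (F n) B l - multi_index (F n) A l" for l
    have "(n, A, B) \<in> ?H k"
      using n A B unfolding heavy_pairs_def by (auto simp: k_def atom_dist_def)
    moreover have "k \<in> K" unfolding K_def k_def using n A(1) B(1) by force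
    ultimately show "x \<in> (\<Union>k\<in>K. ?V k)" using A(2) by blast
  qed
  then have "measure lebesgue E \<le> measure lebesgue (\<Union>k\<in>K. ?V k)"
    using E_meas by (intro measure_mono_fmeasurable fmeasurable.finite_UN[OF finK] V_meas) auto
  also have "\<dots> \<le> (\<Sum>k\<in>K. measure lebesgue (?V k))"
    using finK V_meas by (intro measure_UNION_le) auto
  also have "\<dots> \<le> (\<Sum>k\<in>K. (LINT y:cube a b|lebesgue. \<bar>f y\<bar>) / (t / (S * r ^ nat (\<Sum>l\<in>UNIV. \<bar>k l\<bar>))))"
    using t r \<open>S > 0\<close> by (intro sum_mono heavy_pairs_weak_type[OF F f]) auto
  also have "\<dots> = S / t * (LINT y:cube a b|lebesgue. \<bar>f y\<bar>) * (\<Sum>k\<in>K. r ^ nat (\<Sum>l\<in>UNIV. \<bar>k l\<bar>))"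
    by (simp add: sum_distrib_left sum_divide_distrib mult_ac)
  also have "\<dots> \<le> S / t * (LINT y:cube a b|lebesgue. \<bar>f y\<bar>) * S"
  proof (rule mult_left_mono)
    show "(\<Sum>k\<in>K. r ^ nat (\<Sum>l\<in>UNIV. \<bar>k l\<bar>)) \<le> S" unfolding S by (rule sum_power_l1_le[OF r finK])
    have "0 \<le> (LINT y:cube a b|lebesgue. \<bar>f y\<bar>)"
      unfolding set_lebesgue_integral_def by (intro integral_nonneg_AE) auto
    then show "0 \<le> S / t * (LINT y:cube a b|lebesgue. \<bar>f y\<bar>)" using t \<open>S > 0\<close> by simp
  qed
  finally show "measure lebesgue E \<le> S\<^sup>2 / t * (LINT y:cube a b|lebesgue. \<bar>f y\<bar>)"
    by (simp add: power2_eq_square mult_ac)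
qed

section \<open>Passage to all levels\<close>

theorem proposition3p1:
  fixes q :: real
  assumes "0 \<le> q" and "q < 1"
  shows "\<exists>C::real. \<forall>(a::real) (b::real) (F :: nat \<Rightarrow> 'n::finite \<Rightarrow> real set set) (f :: real^'n \<Rightarrow> real).
           a < b \<longrightarrow> interval_filtration a b F \<longrightarrow> set_integrable lebesgue (cube a b) f \<longrightarrow>
           (\<forall>t::real. t > 0 \<longrightarrow>
              {x \<in> cube a b. maximal_fun q a b F f x > ennreal t} \<in> sets lebesgue \<and>
              emeasure lebesgue {x \<in> cube a b. maximal_fun q a b F f x > ennreal t}
                \<le> ennreal (C / t * (LINT y:cube a b|lebesgue. \<bar>f y\<bar>)))"
proof -
  \<comment> \<open>This choice is positive even for \<open>q = 0\<close>, as needed for dividing by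
    powers of \<open>r\<close>.\<close>
  define r where "r = (1 + q) / 2"
  define S where "S = (2 / (1 - r)) ^ CARD('n)"
  have r: "0 < r" "r < 1" using assms by (auto simp: r_def)
  have "0 \<le> ((1 - q) / 2)\<^sup>2" by simp
  also have "\<dots> = r\<^sup>2 - q" by (simp add: r_def power2_eq_square field_simps)
  finally have q: "q \<le> r\<^sup>2" by simp
  show ?thesis
  proof (rule exI[of _ "S\<^sup>2"], intro allI impI)
    fix a b :: real and F :: "nat \<Rightarrow> 'n \<Rightarrow> real set set" and f :: "real^'n \<Rightarrow> real" and t :: real
    assume F: "interval_filtration a b F" and f: "set_integrable lebesgue (cube a b) f" and t: "t > 0"
    \<comment> \<open>Truncations at level \<open>N\<close> increase to the full level set and have
      a common bound, so continuity from below finishes the proof.\<close>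
    define E where "E N = (\<Union>n\<in>{1..N}. \<Union>{A \<in> atoms (prod_sigma_algebra a b (F n)).
      weighted_avg q a b (F n) f A > t})" for N
    let ?bound = "S\<^sup>2 / t * (LINT y:cube a b|lebesgue. \<bar>f y\<bar>)"
    have E: "E N \<in> lmeasurable" "measure lebesgue (E N) \<le> ?bound" for N
      using finite_levels_weak_type[OF F f assms(1) q r t S_def E_def] by blast+
    have "maximal_fun q a b F f x > ennreal t \<longleftrightarrow>
        (\<exists>n\<ge>1. weighted_avg q a b (F n) f (atom_at (prod_sigma_algebra a b (F n)) x) > t)" for x
      unfolding maximal_fun_def weighted_avg_def less_SUP_iff using t by (auto simp: ennreal_less_iff)
    then have "{x \<in> cube a b. maximal_fun q a b F f x > ennreal t} = (\<Union>n\<in>{1..}.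
        {x \<in> cube a b. weighted_avg q a b (F n) f (atom_at (prod_sigma_algebra a b (F n)) x) > t})"
      by auto
    also have "\<dots> = (\<Union>n\<in>{1..}. \<Union>{A \<in> atoms (prod_sigma_algebra a b (F n)). weighted_avg q a b (F n) f A > t})"
    proof (rule SUP_cong)
      fix n :: nat assume "n \<in> {1..}"
      then have "n \<ge> 1" by simp
      then show "{x \<in> cube a b. weighted_avg q a b (F n) f (atom_at (prod_sigma_algebra a b (F n)) x) > t}
          = \<Union>{A \<in> atoms (prod_sigma_algebra a b (F n)). weighted_avg q a b (F n) f A > t}"
        by (intro weighted_avg_level_set interval_filtration_level[OF F])
    qed simp
    also have "\<dots> = (\<Union>N. E N)" unfolding E_def by fastforce
    finally have eq: "{x \<in> cube a b. maximal_fun q a b F f x > ennreal t} = (\<Union>N. E N)" .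
    have sets: "range E \<subseteq> sets lebesgue" using E(1) by blast
    have "incseq E" unfolding E_def by (intro incseq_SucI UN_mono) auto
    then have "emeasure lebesgue (\<Union>N. E N) = (SUP N. emeasure lebesgue (E N))"
      using SUP_emeasure_incseq[OF sets] by simp
    also have "\<dots> \<le> ennreal ?bound"
      using E by (intro SUP_least) (simp add: emeasure_eq_measure2 ennreal_leI)
    finally show "{x \<in> cube a b. maximal_fun q a b F f x > ennreal t} \<in> sets lebesgue \<and>
        emeasure lebesgue {x \<in> cube a b. maximal_fun q a b F f x > ennreal t} \<le> ennreal ?bound"
      unfolding eq using sets by blast
  qed
qed

end
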